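(* Let $1<p<\infty$ and let $\Phi:[1,\infty)\to(0,\infty)$ be an increasing function such that $$\|S\|_{L^p(w)\to L^{p,\infty}(w)}\le\Phi([w]_{A_p})$$ for all $w\in A_p$, where $S$ is the Haar square function on $\mathbb R$. Then $\Phi(t)\ge c\,t^{1/2}$ for all $t\ge1$, where $c>0$ is a constant depending only on $p$.
   Context: Let $\mathcal D$ be the standard dyadic intervals of $\mathbb R$, and for $I\in\mathcal D$ let $h_I=|I|^{-1/2}(\mathbf 1_{I_-}-\mathbf 1_{I_+})$ be the $L^2$-normalized Haar function, where $I_-,I_+$ are the left and right halves of $I$. The Haar square function is $$Sf:=\Big(\sum_{I\in\mathcal D}\frac{\mathbf 1_I}{|I|}\,|\langle h_I,f\rangle|^2\Big)^{1/2},\qquad\langle h_I,f\rangle=\int h_I f\,dx.$$ A weight is a locally integrable, a.e. positive function; $L^p(w)$, $L^{p,\infty}(w)$ are taken with respect to the measure $w\,dx$, with $\|g\|_{L^{p,\infty}(w)}=\sup_{t>0}t\,w(\{|g|>t\})^{1/p}$, $w(E)=\int_E w\,dx$. $\|S\|_{L^p(w)\to L^{p,\infty}(w)}$ is the least $N\in[0,\infty]$ such that $\|Sf\|_{L^{p,\infty}(w)}\le N\|f\|_{L^p(w)}$ for all locally integrable $f\in L^p(w)$. With $\sigma:=w^{1-p'}$, $p'=p/(p-1)$, the (dyadic) $A_p$ characteristic is $$[w]_{A_p}:=\sup_{I\in\mathcal D}\Big(\frac1{|I|}\int_I w\,dx\Big)\Big(\frac1{|I|}\int_I\sigma\,dx\Big)^{p-1},$$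 and $w\in A_p$ means $[w]_{A_p}<\infty$. (Always $[w]_{A_p}\ge1$.) "Increasing" means nondecreasing. *)

theory Defs
  imports "HOL-Analysis.Analysis"
begin

section \<open>Real powers of extended nonnegative numbers\<close>

text \<open>Only used with a positive exponent, where infinity is mapped to infinity and 0 to 0.\<close>

definition epowr :: "ennreal \<Rightarrow> real \<Rightarrow> ennreal" where
  "epowr a r = (if a = \<infinity> then \<infinity> else ennreal (enn2real a powr r))"


section \<open>Dyadic intervals, Haar functions and the Haar square function\<close>

text \<open>
  The standard dyadic intervals are indexed injectively by pairs of integers: the interval with
  index \<open>(k, j)\<close> is \<open>[j 2\<^sup>k, (j + 1) 2\<^sup>k)\<close>. Sums and suprema over all dyadic intervals
  are sums and suprema over all such pairs.
\<close>

definition dyadic_length :: "int \<Rightarrow> real" where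
  "dyadic_length k = 2 powi k"

definition dyadic :: "int \<Rightarrow> int \<Rightarrow> real set" where
  "dyadic k j = {of_int j * dyadic_length k ..< (of_int j + 1) * dyadic_length k}"

definition dyadic_left :: "int \<Rightarrow> int \<Rightarrow> real set" where
  "dyadic_left k j = {of_int j * dyadic_length k ..< (of_int j + 1 / 2) * dyadic_length k}"

definition dyadic_right :: "int \<Rightarrow> int \<Rightarrow> real set" where
  "dyadic_right k j = {(of_int j + 1 / 2) * dyadic_length k ..< (of_int j + 1) * dyadic_length k}"

definition haar :: "int \<Rightarrow> int \<Rightarrow> real \<Rightarrow> real" where
  "haar k j x = dyadic_length k powr (- 1 / 2) *
     (indicator (dyadic_left k j) x - indicator (dyadic_right k j) x)"

definition haar_coeff :: "int \<Rightarrow> int \<Rightarrow> (real \<Rightarrow> real) \<Rightarrow> real" where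
  "haar_coeff k j f = (LINT x|lebesgue. haar k j x * f x)"

definition haar_square :: "(real \<Rightarrow> real) \<Rightarrow> real \<Rightarrow> ennreal" where
  "haar_square f x = epowr
     (\<Sum>\<^sub>\<infinity>(k, j)\<in>UNIV.
        ennreal (indicator (dyadic k j) x / dyadic_length k * \<bar>haar_coeff k j f\<bar>\<^sup>2)) (1 / 2)"


section \<open>Weights and weighted spaces\<close>

text \<open>
  Integrability on every interval \<open>{-n..n}\<close> includes Lebesgue measurability, so no separate
  measurability hypothesis is needed.
\<close>

definition locally_integrable :: "(real \<Rightarrow> real) \<Rightarrow> bool" where
  "locally_integrable f \<longleftrightarrow> (\<forall>K. compact K \<longrightarrow> f absolutely_integrable_on K)"

definition weight :: "(real \<Rightarrow> real) \<Rightarrow> bool" where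
  "weight w \<longleftrightarrow> locally_integrable w \<and> (AE x in lebesgue. 0 < w x)"

definition weight_measure :: "(real \<Rightarrow> real) \<Rightarrow> real measure" where
  "weight_measure w = density lebesgue (\<lambda>x. ennreal (w x))"

definition Lp_norm :: "real \<Rightarrow> (real \<Rightarrow> real) \<Rightarrow> (real \<Rightarrow> real) \<Rightarrow> ennreal" where
  "Lp_norm p w f = epowr (\<integral>\<^sup>+ x. ennreal (\<bar>f x\<bar> powr p) \<partial>weight_measure w) (1 / p)"

definition weak_Lp_norm :: "real \<Rightarrow> (real \<Rightarrow> real) \<Rightarrow> (real \<Rightarrow> ennreal) \<Rightarrow> ennreal" where
  "weak_Lp_norm p w g =
     (SUP t\<in>{0<..}. ennreal t * epowr (emeasure (weight_measure w) {x. ennreal t < g x}) (1 / p))"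

text \<open>
  The operator norm from \<open>L\<^sup>p(w)\<close> to weak \<open>L\<^sup>p(w)\<close>; it may be infinite. For a weight
  \<open>w\<close> the defining set contains \<open>\<infinity>\<close> (if \<open>f\<close> has norm 0, then \<open>f = 0\<close> a.e.), and it
  is closed under infima, so the infimum is its least element.
\<close>

definition weak_op_norm ::
    "real \<Rightarrow> (real \<Rightarrow> real) \<Rightarrow> ((real \<Rightarrow> real) \<Rightarrow> real \<Rightarrow> ennreal) \<Rightarrow> ennreal" where
  "weak_op_norm p w T = Inf {N. \<forall>f. locally_integrable f \<and> Lp_norm p w f < \<infinity> \<longrightarrow>
     weak_Lp_norm p w (T f) \<le> N * Lp_norm p w f}"

definition conj_exp :: "real \<Rightarrow> real" where
  "conj_exp p = p / (p - 1)"

definition dual_weight :: "real \<Rightarrow> (real \<Rightarrow> real) \<Rightarrow> real \<Rightarrow> real" where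
  "dual_weight p w x = w x powr (1 - conj_exp p)"

definition dyadic_average :: "int \<Rightarrow> int \<Rightarrow> (real \<Rightarrow> real) \<Rightarrow> ennreal" where
  "dyadic_average k j u =
     ennreal (1 / dyadic_length k) * (\<integral>\<^sup>+ x \<in> dyadic k j. ennreal (u x) \<partial>lebesgue)"

definition Ap_char :: "real \<Rightarrow> (real \<Rightarrow> real) \<Rightarrow> ennreal" where
  "Ap_char p w = (SUP (k, j)\<in>UNIV.
     dyadic_average k j w * epowr (dyadic_average k j (dual_weight p w)) (p - 1))"

definition Ap_weights :: "real \<Rightarrow> (real \<Rightarrow> real) set" where
  "Ap_weights p = {w. weight w \<and> Ap_char p w < \<infinity>}"

end

theory Submission
  imports Defs
begin

text \<open>
  Put \<open>\<delta> = 1 / t\<close> and let \<open>w x = x\<^sup>\<delta>\<^sup>-\<^sup>1\<close> on the positive half-line. Then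
  \<open>[w]\<^sub>A\<^sub>p \<le> t\<close> (\<open>Ap_char_power_weight_le\<close>), although \<open>w\<close> is strongly concentrated at the origin: it
  gives mass \<open>t b\<^sup>\<delta>\<close> to \<open>[0, b]\<close>, so one has to go down about \<open>1 / \<delta> = t\<close> dyadic generations from \<open>[0, 1)\<close> before the
  mass of \<open>[0, 2\<^sup>-\<^sup>N]\<close> drops below a fixed fraction of the mass of \<open>[0, 1)\<close>.

  A bounded function can have all its Haar oscillations over these generations of the same size:
  let \<open>f\<close> be \<open>1\<close> and \<open>-1\<close> alternately on the annuli \<open>[2\<^sup>-\<^sup>m\<^sup>-\<^sup>1, 2\<^sup>-\<^sup>m)\<close>. Each interval
  \<open>[0, 2\<^sup>-\<^sup>m)\<close> adds at least \<open>1 / 4\<close> to \<open>(S f)\<^sup>2\<close> (\<open>haar_coeff_alternating_ge\<close>), and hence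
  \<open>S f \<ge> \<surd>N / 2\<close> on \<open>[0, 2\<^sup>-\<^sup>N]\<close>. With \<open>N\<close> about \<open>t\<close> this set carries a fixed part of the mass of
  \<open>[0, 1)\<close>, whereas \<open>\<bar>f\<bar> \<le> 1\<close> is supported in \<open>[0, 1)\<close>. Comparing the weak norm of \<open>S f\<close> with the
  norm of \<open>f\<close> gives an operator norm of at least a multiple of \<open>\<surd>t\<close>
  (\<open>weak_op_norm_haar_square_ge\<close>), and monotonicity of \<open>\<Phi>\<close> carries the bound from
  \<open>\<Phi> ([w]\<^sub>A\<^sub>p)\<close> to \<open>\<Phi> t\<close>. The constant obtained is \<open>1 / 16\<close>, for every \<open>p\<close>.
\<close>


section \<open>Real powers of extended nonnegative numbers\<close>

lemma epowr_ennreal: "0 \<le> a \<Longrightarrow> epowr (ennreal a) r = ennreal (a powr r)"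
  by (simp add: epowr_def)

lemma epowr_mono:
  assumes "a \<le> b" and "0 \<le> r"
  shows "epowr a r \<le> epowr b r"
proof (cases "b = \<infinity>")
  case False
  then have "enn2real a \<le> enn2real b" "a \<noteq> \<infinity>"
    using assms by (auto simp: enn2real_mono less_top top_unique)
  then show ?thesis
    using False assms by (auto simp: epowr_def intro!: ennreal_leI powr_mono2)
qed (simp add: epowr_def)

lemma borel_measurable_epowr [measurable]: "(\<lambda>a. epowr a r) \<in> borel_measurable borel"
  unfolding epowr_def by measurable


section \<open>Measurability and a lower bound for the square function\<close>

text \<open>
  The level sets of the square function need to be measurable: otherwise they would have measure
  \<open>0\<close> by convention, and the weak norm could not be bounded below by passing to a subset. The
  index set is countable, so the infinite sum is a supremum of countably many finite sums.
\<close>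

lemma borel_measurable_haar_square [measurable]: "haar_square f \<in> borel_measurable lebesgue"
proof -
  have 1: "(\<lambda>x. SUP F\<in>{F. finite F \<and> F \<subseteq> UNIV}. \<Sum>q\<in>F. case q of (k, j) \<Rightarrow>
      ennreal (indicator (dyadic k j) x / dyadic_length k * \<bar>haar_coeff k j f\<bar>\<^sup>2))
        \<in> borel_measurable lebesgue"
  proof (rule borel_measurable_SUP)
    show "countable {F :: (int \<times> int) set. finite F \<and> F \<subseteq> UNIV}"
      by (simp add: countable_Collect_finite)
  next
    fix F :: "(int \<times> int) set"
    have [measurable]: "dyadic k j \<in> sets lebesgue" for k j
      by (simp add: dyadic_def)
    show "(\<lambda>x. \<Sum>q\<in>F. case q of (k, j) \<Rightarrow>
        ennreal (indicator (dyadic k j) x / dyadic_length k * \<bar>haar_coeff k j f\<bar>\<^sup>2))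
          \<in> borel_measurable lebesgue"
      by (intro borel_measurable_sum) (auto simp: split_beta)
  qed
  show ?thesis
    unfolding haar_square_def
    by (rule measurable_compose[OF _ borel_measurable_epowr])
      (subst nonneg_infsum_complete, simp, rule 1)
qed

lemma haar_square_ge_of_finite_sum:
  assumes "finite F" and "0 \<le> s"
    and "s\<^sup>2 \<le> (\<Sum>(k, j)\<in>F. indicator (dyadic k j) x / dyadic_length k * \<bar>haar_coeff k j f\<bar>\<^sup>2)"
  shows "ennreal s \<le> haar_square f x"
proof -
  have "ennreal (s\<^sup>2) \<le> (\<Sum>(k, j)\<in>F.
      ennreal (indicator (dyadic k j) x / dyadic_length k * \<bar>haar_coeff k j f\<bar>\<^sup>2))"
    using ennreal_leI[OF assms(3)]
    by (subst (asm) sum_ennreal[symmetric]) (auto simp: split_beta dyadic_length_def)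
  also have "\<dots> \<le> (\<Sum>\<^sub>\<infinity>(k, j)\<in>UNIV.
      ennreal (indicator (dyadic k j) x / dyadic_length k * \<bar>haar_coeff k j f\<bar>\<^sup>2))"
    using assms(1) by (subst nonneg_infsum_complete) (auto intro!: SUP_upper)
  finally have "epowr (ennreal (s\<^sup>2)) (1 / 2) \<le> haar_square f x"
    unfolding haar_square_def by (intro epowr_mono) auto
  then show ?thesis
    using assms(2) by (simp add: epowr_ennreal powr_half_sqrt)
qed


section \<open>A bounded function with a large square function near the origin\<close>

definition alternating :: "real \<Rightarrow> real" where
  "alternating x = (if 0 < x \<and> x < 1 then if even \<lfloor>log 2 x\<rfloor> then 1 else - 1 else 0)"

lemma borel_measurable_alternating [measurable]: "alternating \<in> borel_measurable borel"
  unfolding alternating_def by measurable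

lemma abs_alternating_le_one: "\<bar>alternating x\<bar> \<le> 1"
  by (simp add: alternating_def)

lemma alternating_on_dyadic_annulus:
  assumes "k < 0" and "2 powi k \<le> x" and "x < 2 powi (k + 1)"
  shows "alternating x = (if even k then 1 else - 1)"
proof -
  have "0 < x"
    using assms(2) by (smt (verit) zero_less_power_int)
  have "(2::real) powi (k + 1) \<le> 2 powi 0"
    using assms(1) by (intro power_int_increasing) auto
  then have "x < 1"
    using assms(3) by simp
  have "\<lfloor>log 2 x\<rfloor> = k"
    using assms \<open>0 < x\<close> powr_real_of_int'[of 2 k] powr_real_of_int'[of 2 "k + 1"]
    by (simp add: floor_log_eq_powr_iff)
  then show ?thesis
    using \<open>0 < x\<close> \<open>x < 1\<close> by (simp add: alternating_def)
qed

lemma locally_integrable_alternating: "locally_integrable alternating"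
  unfolding locally_integrable_def
proof (intro allI impI)
  fix K :: "real set"
  assume "compact K"
  then have K [measurable]: "K \<in> sets lebesgue" "emeasure lebesgue K < \<infinity>"
    using lmeasurable_compact by (auto simp only: fmeasurable_def)
  then have "integrable lebesgue (indicator K :: real \<Rightarrow> real)"
    by (rule integrable_real_indicator)
  moreover have [measurable]: "alternating \<in> borel_measurable lebesgue"
    by (intro measurable_completion) simp
  ultimately show "alternating absolutely_integrable_on K"
    unfolding set_integrable_def
    by (elim Bochner_Integration.integrable_bound)
      (auto simp: indicator_def abs_alternating_le_one)
qed

text \<open>
  Let \<open>L\<close> be the length of the interval and \<open>e\<close> the value of the function on the right half
  \<open>[L/2, L)\<close>. The values \<open>-e\<close> on \<open>[L/4, L/2)\<close> and \<open>e\<close> on \<open>[L/2, L)\<close> are both seen by the Haar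
  function with the sign \<open>-e\<close>, so these two pieces add up to \<open>3L/4\<close>; the remaining piece
  \<open>[0, L/4)\<close> can cancel at most \<open>L/4\<close>, whatever happens there. At least \<open>L/2\<close> is left,
  times the factor \<open>L powr (- 1 / 2)\<close> from the normalization.
\<close>

lemma haar_coeff_alternating_ge:
  assumes "k \<le> 0"
  shows "1 / 4 \<le> \<bar>haar_coeff k 0 alternating\<bar>\<^sup>2 / dyadic_length k"
proof -
  define L where "L = dyadic_length k"
  define e :: real where "e = (if even (k - 1) then 1 else - 1)"
  have L: "0 < L" "2 powi (k - 1) = L / 2" "2 powi (k - 2) = L / 4"
    by (simp_all add: L_def dyadic_length_def power_int_diff)
  have outer: "alternating x = e" if "L / 2 \<le> x" "x < L" for x
    using alternating_on_dyadic_annulus[of "k - 1" x] that assms L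
    by (simp add: e_def L_def dyadic_length_def)
  have inner: "alternating x = - e" if "L / 4 \<le> x" "x < L / 2" for x
  proof -
    have "k - 2 + 1 = k - 1" by simp
    then show ?thesis
      using alternating_on_dyadic_annulus[of "k - 2" x] that assms L by (simp add: e_def)
  qed
  have [measurable]: "alternating \<in> borel_measurable lebesgue"
    by (intro measurable_completion) simp
  have int_ind: "integrable lebesgue (indicator {a..<b} :: real \<Rightarrow> real)" for a b :: real
    by (cases "a \<le> b") (auto intro!: integrable_real_indicator)
  have haar_eq: "haar k 0 x = L powr (- 1 / 2) * (indicator {0..<L/2} x - indicator {L/2..<L} x)" for x
    by (simp add: haar_def dyadic_left_def dyadic_right_def L_def)
  have int_h: "integrable lebesgue (haar k 0)"
    unfolding haar_eq by (intro integrable_mult_right Bochner_Integration.integrable_diff int_ind)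
  have int_hf: "integrable lebesgue (\<lambda>x. haar k 0 x * alternating x)"
    by (rule Bochner_Integration.integrable_bound[OF int_h])
      (use abs_alternating_le_one int_h in \<open>auto simp: abs_mult mult_left_le\<close>)
  have "e * haar_coeff k 0 alternating = (LINT x|lebesgue. e * (haar k 0 x * alternating x))"
    by (simp add: haar_coeff_def)
  also have "\<dots> \<le> (LINT x|lebesgue. L powr (- 1 / 2) * (indicator {0..<L/4} x - indicator {L/4..<L} x))"
  proof (rule integral_mono)
    fix x :: real
    have "e * ((indicator {0..<L/2} x - indicator {L/2..<L} x) * alternating x)
        \<le> indicator {0..<L/4} x - indicator {L/4..<L} x"
    proof -
      have "e * e = 1" "\<bar>e\<bar> = 1"
        by (auto simp: e_def)
      moreover have "e * alternating x \<le> 1"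
        using abs_alternating_le_one[of x] by (auto simp: e_def)
      ultimately show ?thesis
        using outer[of x] inner[of x] L(1) by (auto simp: indicator_def)
    qed
    then have "L powr (- 1 / 2) * (e * ((indicator {0..<L/2} x - indicator {L/2..<L} x) * alternating x))
        \<le> L powr (- 1 / 2) * (indicator {0..<L/4} x - indicator {L/4..<L} x)"
      by (rule mult_left_mono) simp
    then show "e * (haar k 0 x * alternating x)
        \<le> L powr (- 1 / 2) * (indicator {0..<L/4} x - indicator {L/4..<L} x)"
      by (simp only: haar_eq mult_ac)
  qed (intro integrable_mult_right int_hf Bochner_Integration.integrable_diff int_ind)+
  also have "\<dots> = L powr (- 1 / 2) * (L / 4 - 3 * L / 4)"
    using L(1) int_ind by (simp add: Bochner_Integration.integral_diff)
  finally have "L powr (- 1 / 2) * (L / 2) \<le> \<bar>haar_coeff k 0 alternating\<bar>"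
    by (auto simp: e_def algebra_simps split: if_splits)
  then have "(L powr (- 1 / 2) * (L / 2))\<^sup>2 \<le> \<bar>haar_coeff k 0 alternating\<bar>\<^sup>2"
    using L(1) by (intro power_mono) auto
  moreover have "(L powr (- 1 / 2))\<^sup>2 = 1 / L"
    using L(1) by (simp add: powr_minus powr_half_sqrt power_divide field_simps)
  ultimately show ?thesis
    using L(1) by (simp add: power_mult_distrib power2_eq_square field_simps flip: L_def)
qed

lemma haar_square_alternating_ge:
  assumes "0 \<le> x" and "x \<le> 1 / 2 ^ N"
  shows "ennreal (sqrt N / 2) \<le> haar_square alternating x"
proof -
  define F :: "(int \<times> int) set" where "F = (\<lambda>m. (- int m, 0)) ` {..<N}"
  have "(sqrt N / 2)\<^sup>2 = (\<Sum>m<N. 1 / 4)"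
    by (simp add: power_divide)
  also have "\<dots> \<le> (\<Sum>m<N. indicator (dyadic (- int m) 0) x / dyadic_length (- int m)
      * \<bar>haar_coeff (- int m) 0 alternating\<bar>\<^sup>2)"
  proof (rule sum_mono)
    fix m
    assume "m \<in> {..<N}"
    then have "(2::real) ^ m < 2 ^ N"
      by (intro power_strict_increasing) auto
    then have "1 / 2 ^ N < (1::real) / 2 ^ m"
      by (intro divide_strict_left_mono) auto
    then have "x < 1 / 2 ^ m"
      using assms(2) by linarith
    then have "x \<in> dyadic (- int m) 0"
      using assms(1) by (simp add: dyadic_def dyadic_length_def power_int_minus divide_inverse)
    then show "1 / 4 \<le> indicator (dyadic (- int m) 0) x / dyadic_length (- int m)
        * \<bar>haar_coeff (- int m) 0 alternating\<bar>\<^sup>2"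
      using haar_coeff_alternating_ge[of "- int m"] by simp
  qed
  also have "\<dots> = (\<Sum>(k, j)\<in>F. indicator (dyadic k j) x / dyadic_length k
      * \<bar>haar_coeff k j alternating\<bar>\<^sup>2)"
    unfolding F_def by (subst sum.reindex) (auto simp: inj_on_def)
  finally show ?thesis
    by (intro haar_square_ge_of_finite_sum[of F]) (auto simp: F_def)
qed


section \<open>The power weight and its characteristic\<close>

text \<open>
  No dyadic interval has the origin in its interior, so the two half-lines do not interact and the
  weight may be constant on the negative one. At the origin \<open>0 powr (\<delta> - 1) = 0\<close>, which makes the
  dual weight \<open>0\<close> there; thus for \<open>\<delta> \<le> 1\<close> the dual weight is nondecreasing on the closed half-line.
\<close>

definition power_weight :: "real \<Rightarrow> real \<Rightarrow> real" where
  "power_weight \<delta> x = (if x < 0 then 1 else x powr (\<delta> - 1))"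

lemma power_weight_nonneg: "0 \<le> power_weight \<delta> x"
  by (simp add: power_weight_def)

lemma borel_measurable_power_weight [measurable]: "power_weight \<delta> \<in> borel_measurable borel"
  unfolding power_weight_def by measurable

lemma has_integral_power_weight:
  assumes "0 < \<delta>" and "0 \<le> a" and "a \<le> b"
  shows "(power_weight \<delta> has_integral (b powr \<delta> - a powr \<delta>) / \<delta>) {a..b}"
proof -
  have "(power_weight \<delta> has_integral (b powr \<delta> / \<delta> - a powr \<delta> / \<delta>)) {a..b}"
  proof (rule fundamental_theorem_of_calculus_interior)
    show "continuous_on {a..b} (\<lambda>x. x powr \<delta> / \<delta>)"
      using assms by (intro continuous_intros continuous_on_powr') auto
    fix x
    assume "x \<in> {a<..<b}"
    then have "((\<lambda>x. x powr \<delta> / \<delta>) has_real_derivative power_weight \<delta> x) (at x)"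
      using assms by (auto intro!: derivative_eq_intros simp: power_weight_def powr_diff)
    then show "((\<lambda>x. x powr \<delta> / \<delta>) has_vector_derivative power_weight \<delta> x) (at x)"
      by (simp add: has_real_derivative_iff_has_vector_derivative)
  qed (use assms in auto)
  then show ?thesis
    by (simp add: diff_divide_distrib)
qed

lemma nn_integral_power_weight:
  assumes "0 < \<delta>" and "0 \<le> a" and "a \<le> b"
  shows "(\<integral>\<^sup>+ x \<in> {a..b}. ennreal (power_weight \<delta> x) \<partial>lebesgue)
    = ennreal ((b powr \<delta> - a powr \<delta>) / \<delta>)"
  using nn_integral_has_integral_lebesgue'[OF _ has_integral_power_weight[OF assms]]
  by (simp add: power_weight_nonneg nn_integral_completion)

lemma weight_power_weight:
  assumes "0 < \<delta>"
  shows "weight (power_weight \<delta>)"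
  unfolding weight_def
proof
  show "AE x in lebesgue. 0 < power_weight \<delta> x"
  proof (rule AE_mp)
    show "AE x in lebesgue. x \<noteq> (0::real)"
      by (rule AE_completion) (rule AE_lborel_singleton)
  qed (simp add: power_weight_def)
  show "locally_integrable (power_weight \<delta>)"
    unfolding locally_integrable_def
  proof (intro allI impI)
    fix K :: "real set"
    assume "compact K"
    then obtain b where b: "\<And>x. x \<in> K \<Longrightarrow> \<bar>x\<bar> \<le> b" "0 < b"
      using compact_imp_bounded by (metis bounded_pos real_norm_def)
    have neg: "power_weight \<delta> integrable_on {-b..0}"
    proof (rule integrable_spike)
      show "(\<lambda>x. 1 :: real) integrable_on {-b..0}"
        by (simp add: integrable_const_ivl)
    qed (auto simp: power_weight_def intro!: negligible_sing[of 0])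
    have "power_weight \<delta> integrable_on {0..b}"
      using has_integral_power_weight[OF assms, of 0 b] b(2) by (auto simp: integrable_on_def)
    with neg have "power_weight \<delta> integrable_on {-b..b}"
      using b(2) by (intro Henstock_Kurzweil_Integration.integrable_combine[of "-b" 0 b]) auto
    then have "power_weight \<delta> absolutely_integrable_on {-b..b}"
      by (intro nonnegative_absolutely_integrable_1) (auto simp: power_weight_nonneg)
    then show "power_weight \<delta> absolutely_integrable_on K"
    proof (rule set_integrable_subset)
      show "K \<in> sets lebesgue"
        using \<open>compact K\<close> by (intro fmeasurableD lmeasurable_compact)
      show "K \<subseteq> {-b..b}"
        using b(1) by force
    qed
  qed
qed

lemma dyadic_nonneg_or_neg:
  assumes "x \<in> dyadic k j"
  shows "0 \<le> j \<Longrightarrow> 0 \<le> x" and "j < 0 \<Longrightarrow> x < 0"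
proof -
  have L: "0 < dyadic_length k"
    by (simp add: dyadic_length_def)
  show "0 \<le> x" if "0 \<le> j"
  proof -
    have "0 \<le> of_int j * dyadic_length k"
      using L that by simp
    then show ?thesis
      using assms by (auto simp: dyadic_def)
  qed
  show "x < 0" if "j < 0"
  proof -
    have "(of_int j + 1) * dyadic_length k \<le> 0"
      using L that by (intro mult_nonpos_nonneg) auto
    then show ?thesis
      using assms by (auto simp: dyadic_def)
  qed
qed

lemma dyadic_average_le_const:
  assumes "\<And>x. x \<in> dyadic k j \<Longrightarrow> u x \<le> c"
  shows "dyadic_average k j u \<le> ennreal c"
proof -
  have L: "0 < dyadic_length k"
    by (simp add: dyadic_length_def)
  have "(\<integral>\<^sup>+ x \<in> dyadic k j. ennreal (u x) \<partial>lebesgue)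
      \<le> (\<integral>\<^sup>+ x. ennreal c * indicator (dyadic k j) x \<partial>lebesgue)"
    by (intro nn_integral_mono) (auto simp: indicator_def intro!: ennreal_leI assms)
  also have "\<dots> = ennreal c * ennreal (dyadic_length k)"
    using L by (subst nn_integral_cmult_indicator)
      (auto simp: dyadic_def algebra_simps)
  finally have "dyadic_average k j u \<le>
      ennreal (1 / dyadic_length k) * (ennreal c * ennreal (dyadic_length k))"
    unfolding dyadic_average_def by (intro mult_left_mono) auto
  also have "\<dots> = ennreal c * (ennreal (1 / dyadic_length k) * ennreal (dyadic_length k))"
    by (simp only: mult_ac)
  also have "ennreal (1 / dyadic_length k) * ennreal (dyadic_length k) = 1"
    using L by (simp flip: ennreal_mult)
  finally show ?thesis
    by simp
qed

lemma dyadic_average_eq_one: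
  assumes "\<And>x. x \<in> dyadic k j \<Longrightarrow> u x = 1"
  shows "dyadic_average k j u = 1"
proof -
  have L: "0 < dyadic_length k"
    by (simp add: dyadic_length_def)
  have "(\<integral>\<^sup>+ x \<in> dyadic k j. ennreal (u x) \<partial>lebesgue)
      = (\<integral>\<^sup>+ x. indicator (dyadic k j) x \<partial>lebesgue)"
    by (intro nn_integral_cong) (auto simp: indicator_def assms)
  also have "\<dots> = ennreal (dyadic_length k)"
    using L by (subst nn_integral_indicator)
      (auto simp: dyadic_def algebra_simps)
  finally show ?thesis
    using L by (simp add: dyadic_average_def flip: ennreal_mult)
qed

text \<open>
  On \<open>[0, b)\<close> the average is exactly \<open>b powr (\<delta> - 1) / \<delta>\<close>. As the weight does not increase on the
  positive half-line, the average over \<open>[a, b)\<close> is no larger.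
\<close>

lemma dyadic_average_power_weight_le:
  fixes j k :: int
  assumes \<delta>: "0 < \<delta>" "\<delta> \<le> 1" and "0 \<le> j"
  defines "b \<equiv> (of_int j + 1) * dyadic_length k"
  shows "dyadic_average k j (power_weight \<delta>) \<le> ennreal (b powr (\<delta> - 1) / \<delta>)"
proof -
  define L where "L = dyadic_length k"
  define a where "a = of_int j * L"
  have L: "0 < L"
    by (simp add: L_def dyadic_length_def)
  have ab: "0 \<le> a" "b - a = L"
    using L \<open>0 \<le> j\<close> by (auto simp: a_def b_def L_def algebra_simps)
  have "(\<integral>\<^sup>+ x \<in> dyadic k j. ennreal (power_weight \<delta> x) \<partial>lebesgue)
      \<le> (\<integral>\<^sup>+ x \<in> {a..b}. ennreal (power_weight \<delta> x) \<partial>lebesgue)"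
    by (intro nn_integral_mono) (auto simp: indicator_def dyadic_def a_def b_def L_def)
  also have "\<dots> = ennreal ((b powr \<delta> - a powr \<delta>) / \<delta>)"
    using ab L by (intro nn_integral_power_weight \<delta>) auto
  finally have "dyadic_average k j (power_weight \<delta>)
      \<le> ennreal (1 / L) * ennreal ((b powr \<delta> - a powr \<delta>) / \<delta>)"
    unfolding dyadic_average_def L_def[symmetric] by (intro mult_left_mono) auto
  also have "\<dots> = ennreal (1 / L * ((b powr \<delta> - a powr \<delta>) / \<delta>))"
    using ab L \<delta> by (intro ennreal_mult[symmetric]) (auto intro!: divide_nonneg_pos powr_mono2)
  also have "1 / L * ((b powr \<delta> - a powr \<delta>) / \<delta>) \<le> b powr (\<delta> - 1) / \<delta>"
  proof -
    have b: "0 < b" "a \<le> b"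
      using ab L by auto
    have "a * b powr (\<delta> - 1) \<le> a powr \<delta>"
    proof (cases "a = 0")
      case False
      then have "b powr (\<delta> - 1) \<le> a powr (\<delta> - 1)"
        using ab b \<delta> by (intro powr_mono2') auto
      then have "a * b powr (\<delta> - 1) \<le> a * a powr (\<delta> - 1)"
        using ab by (intro mult_left_mono)
      then show ?thesis
        using False ab by (simp add: powr_diff)
    qed simp
    moreover have "b * b powr (\<delta> - 1) = b powr \<delta>"
      using b by (simp add: powr_diff)
    ultimately have "b powr \<delta> - a powr \<delta> \<le> L * b powr (\<delta> - 1)"
      using ab(2) by (simp add: algebra_simps flip: ab(2))
    then have "(b powr \<delta> - a powr \<delta>) / L \<le> b powr (\<delta> - 1)"
      using L by (simp add: pos_divide_le_eq mult.commute)
    then have "(b powr \<delta> - a powr \<delta>) / L / \<delta> \<le> b powr (\<delta> - 1) / \<delta>"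
      using \<delta> by (intro divide_right_mono) auto
    then show ?thesis
      by simp
  qed
  finally show ?thesis
    by (simp add: ennreal_leI)
qed

lemma dyadic_average_dual_power_weight_le:
  fixes j k :: int
  assumes "1 < p" and "\<delta> \<le> 1" and "0 \<le> j"
  defines "b \<equiv> (of_int j + 1) * dyadic_length k"
  shows "dyadic_average k j (dual_weight p (power_weight \<delta>))
    \<le> ennreal (b powr ((1 - \<delta>) / (p - 1)))"
proof (rule dyadic_average_le_const)
  fix x
  assume x: "x \<in> dyadic k j"
  then have x': "0 \<le> x" "x \<le> b"
    using dyadic_nonneg_or_neg(1)[OF x \<open>0 \<le> j\<close>] by (auto simp: dyadic_def b_def)
  have exponent: "(\<delta> - 1) * (1 - conj_exp p) = (1 - \<delta>) / (p - 1)"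
    using assms(1) by (simp add: conj_exp_def field_simps)
  have "dual_weight p (power_weight \<delta>) x = x powr ((1 - \<delta>) / (p - 1))"
    using x' by (simp add: dual_weight_def power_weight_def powr_powr exponent)
  also have "\<dots> \<le> b powr ((1 - \<delta>) / (p - 1))"
    using x' assms by (intro powr_mono2) auto
  finally show "dual_weight p (power_weight \<delta>) x \<le> b powr ((1 - \<delta>) / (p - 1))" .
qed

lemma dyadic_average_power_weight_neg:
  assumes "j < 0"
  shows "dyadic_average k j (power_weight \<delta>) = 1"
    and "dyadic_average k j (dual_weight p (power_weight \<delta>)) = 1"
  using dyadic_nonneg_or_neg(2)[OF _ assms]
  by (auto intro!: dyadic_average_eq_one simp: power_weight_def dual_weight_def)

text \<open>
  On an interval with right endpoint \<open>b > 0\<close> the dual weight is estimated by its value at \<open>b\<close>; since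
  \<open>(1 - \<delta>) / (p - 1)\<close> times \<open>p - 1\<close> is \<open>1 - \<delta>\<close>, the powers of \<open>b\<close> in the two averages cancel.
\<close>

lemma Ap_char_power_weight_le:
  assumes p: "1 < p" and \<delta>: "0 < \<delta>" "\<delta> \<le> 1"
  shows "Ap_char p (power_weight \<delta>) \<le> ennreal (1 / \<delta>)"
  unfolding Ap_char_def
proof (rule SUP_least, clarify)
  fix k j :: int
  let ?A = "dyadic_average k j (power_weight \<delta>)"
  let ?B = "dyadic_average k j (dual_weight p (power_weight \<delta>))"
  show "?A * epowr ?B (p - 1) \<le> ennreal (1 / \<delta>)"
  proof (cases "0 \<le> j")
    case True
    define b where "b = (of_int j + 1) * dyadic_length k"
    have b: "0 < b"
      using True by (simp add: b_def dyadic_length_def)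
    have "epowr ?B (p - 1) \<le> epowr (ennreal (b powr ((1 - \<delta>) / (p - 1)))) (p - 1)"
      using dyadic_average_dual_power_weight_le[OF p \<delta>(2) True] p
      by (intro epowr_mono) (auto simp: b_def)
    also have "\<dots> = ennreal (b powr (1 - \<delta>))"
      using p by (simp add: epowr_ennreal powr_powr)
    finally have "?A * epowr ?B (p - 1)
        \<le> ennreal (b powr (\<delta> - 1) / \<delta>) * ennreal (b powr (1 - \<delta>))"
      using dyadic_average_power_weight_le[OF \<delta> True] by (intro mult_mono) (auto simp: b_def)
    also have "\<dots> = ennreal (b powr (\<delta> - 1) * b powr (1 - \<delta>) / \<delta>)"
      using \<delta> by (simp flip: ennreal_mult)
    also have "b powr (\<delta> - 1) * b powr (1 - \<delta>) = 1"
      using b by (simp flip: powr_add)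
    finally show ?thesis .
  next
    case False
    then have "?A * epowr ?B (p - 1) = 1"
      by (simp add: dyadic_average_power_weight_neg epowr_def)
    also have "\<dots> \<le> ennreal (1 / \<delta>)"
      using \<delta> by (simp add: ennreal_leI flip: ennreal_1)
    finally show ?thesis .
  qed
qed

text \<open>
  Intervals on the negative half-line, where the weight is \<open>1\<close>, are witnesses. The bound places the
  characteristic in the domain \<open>{1..}\<close> on which the function \<open>\<Phi>\<close> of the theorem is monotone.
\<close>

lemma Ap_char_power_weight_ge_one: "1 \<le> Ap_char p (power_weight \<delta>)"
proof -
  have "(1::ennreal) = dyadic_average 0 (-1) (power_weight \<delta>) *
      epowr (dyadic_average 0 (-1) (dual_weight p (power_weight \<delta>))) (p - 1)"
    by (simp add: dyadic_average_power_weight_neg epowr_def)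
  also have "\<dots> \<le> Ap_char p (power_weight \<delta>)"
    unfolding Ap_char_def by (rule SUP_upper2[of "(0, -1)"]) auto
  finally show ?thesis .
qed


section \<open>The lower bound\<close>

lemma emeasure_power_weight_Icc:
  assumes "0 < \<delta>" and "0 \<le> b"
  shows "emeasure (weight_measure (power_weight \<delta>)) {0..b} = ennreal (b powr \<delta> / \<delta>)"
proof -
  have [measurable]: "power_weight \<delta> \<in> borel_measurable lebesgue"
    by (intro measurable_completion) simp
  show ?thesis
    unfolding weight_measure_def
    using nn_integral_power_weight[OF assms(1) order_refl assms(2)] by (simp add: emeasure_density)
qed

lemma Lp_norm_alternating_le:
  assumes "1 < p" and "0 < \<delta>"
  shows "Lp_norm p (power_weight \<delta>) alternating \<le> ennreal ((1 / \<delta>) powr (1 / p))"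
proof -
  have "(\<integral>\<^sup>+ x. ennreal (\<bar>alternating x\<bar> powr p) \<partial>weight_measure (power_weight \<delta>))
      \<le> (\<integral>\<^sup>+ x. indicator {0..1} x \<partial>weight_measure (power_weight \<delta>))"
    by (intro nn_integral_mono) (auto simp: alternating_def)
  also have "\<dots> = emeasure (weight_measure (power_weight \<delta>)) {0..1}"
    by (rule nn_integral_indicator) (simp add: weight_measure_def)
  also have "\<dots> = ennreal (1 / \<delta>)"
    using assms by (simp add: emeasure_power_weight_Icc)
  finally have "Lp_norm p (power_weight \<delta>) alternating \<le> epowr (ennreal (1 / \<delta>)) (1 / p)"
    unfolding Lp_norm_def using assms by (intro epowr_mono) auto
  then show ?thesis
    using assms by (simp add: epowr_ennreal)
qed

text \<open>
  The level \<open>sqrt t / 4\<close> is exceeded on \<open>[0, 1 / 2 ^ N]\<close> with \<open>N = \<lceil>t\<rceil>\<close>. The mass of this set is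
  \<open>t * 2 powr (- N / t)\<close>, and it is at least \<open>t / 4\<close> because \<open>N \<le> 2 * t\<close>.
\<close>

lemma weak_Lp_norm_haar_square_alternating_ge:
  assumes p: "1 < p" and t: "1 \<le> t"
  shows "ennreal (sqrt t / 4 * (t / 4) powr (1 / p))
    \<le> weak_Lp_norm p (power_weight (1 / t)) (haar_square alternating)"
proof -
  define N where "N = nat \<lceil>t\<rceil>"
  define \<mu> where "\<mu> = weight_measure (power_weight (1 / t))"
  have N: "t \<le> N" "N \<le> 2 * t"
    using t ceiling_correct[of t] by (auto simp: N_def)
  \<comment> \<open>the level is half of the available bound, because the level set is defined by a strict inequality\<close>
  have sub: "{0..1 / 2 ^ N} \<subseteq> {x. ennreal (sqrt t / 4) < haar_square alternating x}"
  proof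
    fix x :: real
    assume "x \<in> {0..1 / 2 ^ N}"
    then have x: "0 \<le> x" "x \<le> 1 / 2 ^ N"
      by auto
    have "0 < sqrt t"
      using t by simp
    then have "sqrt t / 4 < sqrt N / 2" "0 < sqrt N / 2"
      using real_sqrt_le_mono[OF N(1)] by linarith+
    then have "ennreal (sqrt t / 4) < ennreal (sqrt N / 2)"
      by (rule ennreal_lessI[rotated])
    also have "\<dots> \<le> haar_square alternating x"
      using x by (rule haar_square_alternating_ge)
    finally show "x \<in> {x. ennreal (sqrt t / 4) < haar_square alternating x}"
      by simp
  qed
  have "1 / 4 \<le> (1 / 2 ^ N :: real) powr (1 / t)"
  proof -
    have "(1 / 2 ^ N :: real) = 2 powr (- N)"
      by (simp add: powr_minus powr_realpow divide_inverse)
    then have "(1 / 2 ^ N :: real) powr (1 / t) = 2 powr (- (N / t))"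
      by (simp add: powr_powr)
    moreover have "2 powr (- 2 :: real) \<le> 2 powr (- (N / t))"
      using N t by (intro powr_mono) (auto simp: field_simps)
    ultimately show ?thesis
      by (simp add: powr_minus)
  qed
  then have "t / 4 \<le> (1 / 2 ^ N) powr (1 / t) / (1 / t)"
    using t by (simp add: field_simps)
  then have "ennreal (t / 4) \<le> emeasure \<mu> {0..1 / 2 ^ N}"
    using t by (simp add: \<mu>_def emeasure_power_weight_Icc ennreal_leI)
  also have "\<dots> \<le> emeasure \<mu> {x. ennreal (sqrt t / 4) < haar_square alternating x}"
  proof (rule emeasure_mono[OF sub])
    have "{x \<in> space lebesgue. ennreal (sqrt t / 4) < haar_square alternating x} \<in> sets lebesgue"
      by measurable
    then show "{x. ennreal (sqrt t / 4) < haar_square alternating x} \<in> sets \<mu>"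
      by (simp add: \<mu>_def weight_measure_def)
  qed
  finally have "ennreal (sqrt t / 4) * epowr (ennreal (t / 4)) (1 / p)
      \<le> ennreal (sqrt t / 4) *
        epowr (emeasure \<mu> {x. ennreal (sqrt t / 4) < haar_square alternating x}) (1 / p)"
    using p by (intro mult_left_mono epowr_mono) auto
  also have "\<dots> \<le> weak_Lp_norm p (power_weight (1 / t)) (haar_square alternating)"
    unfolding weak_Lp_norm_def \<mu>_def using t by (intro SUP_upper) auto
  finally have "ennreal (sqrt t / 4) * ennreal ((t / 4) powr (1 / p))
      \<le> weak_Lp_norm p (power_weight (1 / t)) (haar_square alternating)"
    using t by (simp add: epowr_ennreal)
  moreover have "ennreal (sqrt t / 4 * (t / 4) powr (1 / p))
      = ennreal (sqrt t / 4) * ennreal ((t / 4) powr (1 / p))"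
    using t by (intro ennreal_mult) auto
  ultimately show ?thesis
    by simp
qed

lemma weak_op_norm_haar_square_ge:
  assumes p: "1 < p" and t: "1 \<le> t"
  shows "ennreal (sqrt t / 16) \<le> weak_op_norm p (power_weight (1 / t)) haar_square"
  unfolding weak_op_norm_def
proof (rule Inf_greatest, clarify)
  fix N
  assume N: "\<forall>f. locally_integrable f \<and> Lp_norm p (power_weight (1 / t)) f < \<infinity> \<longrightarrow>
    weak_Lp_norm p (power_weight (1 / t)) (haar_square f) \<le> N * Lp_norm p (power_weight (1 / t)) f"
  have norm: "Lp_norm p (power_weight (1 / t)) alternating \<le> ennreal (t powr (1 / p))"
    using Lp_norm_alternating_le[of p "1 / t"] p t by simp
  then have "Lp_norm p (power_weight (1 / t)) alternating < \<infinity>"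
    by (rule le_less_trans) simp
  then have "weak_Lp_norm p (power_weight (1 / t)) (haar_square alternating)
      \<le> N * Lp_norm p (power_weight (1 / t)) alternating"
    using N locally_integrable_alternating by blast
  also have "\<dots> \<le> N * ennreal (t powr (1 / p))"
    using norm by (intro mult_left_mono) auto
  finally have le: "ennreal (sqrt t / 4 * (t / 4) powr (1 / p)) \<le> N * ennreal (t powr (1 / p))"
    using weak_Lp_norm_haar_square_alternating_ge[OF p t] by (rule order_trans[rotated])
  show "ennreal (sqrt t / 16) \<le> N"
  proof (cases N)
    case (real n)
    have "sqrt t / 4 * (t / 4) powr (1 / p) \<le> n * t powr (1 / p)"
      using le real by (simp flip: ennreal_mult)
    then have "sqrt t / 4 * (1 / 4) powr (1 / p) * t powr (1 / p) \<le> n * t powr (1 / p)"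
      using t by (simp add: powr_divide)
    then have "sqrt t / 4 * (1 / 4) powr (1 / p) \<le> n"
      using t by (simp only: mult_le_cancel_right) auto
    \<comment> \<open>bounding the mass ratio crudely makes the constant independent of \<open>p\<close>\<close>
    moreover have "(1 / 4) powr 1 \<le> (1 / 4 :: real) powr (1 / p)"
      using p by (intro powr_mono') auto
    then have "sqrt t / 4 * (1 / 4) \<le> sqrt t / 4 * (1 / 4) powr (1 / p)"
      using t by (intro mult_left_mono) auto
    ultimately show ?thesis
      using real by (simp add: ennreal_leI)
  qed simp
qed

theorem proposition5p2:
  fixes p :: real
  assumes "1 < p"
  shows "\<exists>c>0. \<forall>\<Phi> :: real \<Rightarrow> real.
    (\<forall>t\<ge>1. 0 < \<Phi> t) \<and> mono_on {1..} \<Phi> \<and>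
    (\<forall>w\<in>Ap_weights p. weak_op_norm p w haar_square \<le> ennreal (\<Phi> (enn2real (Ap_char p w))))
    \<longrightarrow> (\<forall>t\<ge>1. c * t powr (1 / 2) \<le> \<Phi> t)"
proof (intro exI[of _ "1 / 16"] conjI allI impI)
  fix \<Phi> :: "real \<Rightarrow> real" and t :: real
  assume \<Phi>: "(\<forall>t\<ge>1. 0 < \<Phi> t) \<and> mono_on {1..} \<Phi> \<and>
    (\<forall>w\<in>Ap_weights p. weak_op_norm p w haar_square \<le> ennreal (\<Phi> (enn2real (Ap_char p w))))"
    and t: "1 \<le> t"
  have pos: "0 < \<Phi> s" if "1 \<le> s" for s
    using \<Phi> that by blast
  have mono: "mono_on {1..} \<Phi>"
    using \<Phi> by blast
  have bound: "weak_op_norm p w haar_square \<le> ennreal (\<Phi> (enn2real (Ap_char p w)))"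
    if "w \<in> Ap_weights p" for w
    using \<Phi> that by blast
  let ?w = "power_weight (1 / t)"
  have upper: "Ap_char p ?w \<le> ennreal t"
    using Ap_char_power_weight_le[OF assms, of "1 / t"] t by simp
  then have fin: "Ap_char p ?w < \<infinity>"
    by (rule le_less_trans) simp
  have ge_one: "1 \<le> enn2real (Ap_char p ?w)"
    using enn2real_mono[OF Ap_char_power_weight_ge_one[of p "1 / t"]] fin by simp
  have le_t: "enn2real (Ap_char p ?w) \<le> t"
    using enn2real_mono[OF upper] t by simp
  have "?w \<in> Ap_weights p"
    using weight_power_weight[of "1 / t"] fin t by (simp add: Ap_weights_def)
  then have "ennreal (sqrt t / 16) \<le> ennreal (\<Phi> (enn2real (Ap_char p ?w)))"
    by (rule order_trans[OF weak_op_norm_haar_square_ge[OF assms t] bound])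
  then have "sqrt t / 16 \<le> \<Phi> (enn2real (Ap_char p ?w))"
    using pos[OF ge_one] by (subst (asm) ennreal_le_iff) auto
  also have "\<dots> \<le> \<Phi> t"
    using ge_one t by (intro mono_onD[OF mono] le_t) auto
  finally show "1 / 16 * t powr (1 / 2) \<le> \<Phi> t"
    using t by (simp add: powr_half_sqrt)
qed simp

end
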